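(* Let $\mathbf{a}=[\alpha_1,\dots,\alpha_{N+1}]$ be a list of positive integers with greatest common divisor $1$, given with their prime factorizations $\alpha_i=p_1^{a_{i1}}\cdots p_n^{a_{in}}$, and suppose some sublist of $\mathbf{a}$ has greatest common divisor different from $1$. Then there is a polynomial-time algorithm that finds all the largest sublists of $\mathbf{a}$ (sublists of maximum cardinality) whose greatest common divisor is not $1$. Moreover, letting $\ell$ denote the size of these largest sublists: (1) there are polynomially many (in the input size) such sublists; (2) the poset $\tilde P_{>\ell-1}$ is a fan, i.e. $\mathcal{G}_{>\ell-1}(\mathbf{a})=\{1,f_1,\dots,f_m\}$ where $G(1)$ is the maximum element and the elements $G(f_1),\dots,G(f_m)$ are pairwise incomparable (no $f_i$ divides $f_j$ for $i\neq j$); and (3) the Möbius function satisfies $\mu(f)=1$ for $f\ne1$ and $\mu(1)=1-(|\mathcal{G}_{>\ell-1}(\mathbf{a})|-1)$.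
   Context: For an integer $d$, $\mathcal{G}_{>d}(\mathbf{a})$ is the set of integers $\gcd\{\alpha_i:i\in I\}$ over all $I\subseteq\{1,\dots,N+1\}$ with $|I|>d$. For a positive integer $f$ let $G(f)=\{\zeta\in\mathbb{C}:\zeta^f=1\}$. The poset $\tilde P_{>d}$ consists of the groups $G(f)$, $f\in\mathcal{G}_{>d}(\mathbf{a})$, ordered by reverse inclusion: $G(f)\preceq G(g)$ iff $G(g)\subseteq G(f)$, i.e. iff $g\mid f$. The poset $P_{>d}$ is $\tilde P_{>d}$ with an added minimum $\hat 0$. The Möbius function is $\mu(f)=-\mu'(\hat0,G(f))$ where $\mu'$ is the standard Möbius function of $P_{>d}$; equivalently $\mu(f)=1-\sum\mu(g)$ over $g\in\mathcal{G}_{>d}(\mathbf{a})$ with $f\mid g$, $g\ne f$. *)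

theory Defs
  imports Complex_Main "HOL-Computational_Algebra.Computational_Algebra"
begin

section \<open>Sublists and their greatest common divisors\<close>

text \<open>A list \<open>a = [\<alpha>\<^sub>1, \<dots>, \<alpha>\<^bsub>N+1\<^esub>]\<close> has type \<^typ>\<open>nat list\<close>.  A sublist is given by its set of
  positions, a set \<open>I \<subseteq> {..<length a}\<close>; positions are counted from 0.\<close>

definition sublist_gcd :: "nat list \<Rightarrow> nat set \<Rightarrow> nat" where
  "sublist_gcd a I = Gcd ((\<lambda>i. a ! i) ` I)"

definition gcds_gt :: "int \<Rightarrow> nat list \<Rightarrow> nat set" where
  "gcds_gt d a = {sublist_gcd a I | I. I \<subseteq> {..<length a} \<and> int (card I) > d}"

text \<open>The empty sublist is excluded: its gcd is 0 by the library convention, which would make it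
  a sublist with gcd different from 1.\<close>

definition noncoprime_sublist :: "nat list \<Rightarrow> nat set \<Rightarrow> bool" where
  "noncoprime_sublist a I \<longleftrightarrow> I \<noteq> {} \<and> I \<subseteq> {..<length a} \<and> sublist_gcd a I \<noteq> 1"

definition largest_sublists :: "nat list \<Rightarrow> nat set set" where
  "largest_sublists a = {I. is_arg_max card (noncoprime_sublist a) I}"

definition largest_size :: "nat list \<Rightarrow> nat" where
  "largest_size a = Max (card ` {I. noncoprime_sublist a I})"

text \<open>\<open>ps = [p\<^sub>1, \<dots>, p\<^sub>n]\<close> and \<open>E\<close> is the matrix of exponents, given by rows:
  \<open>\<alpha>\<^sub>i = p\<^sub>1 ^ a\<^bsub>i1\<^esub> \<cdots> p\<^sub>n ^ a\<^bsub>in\<^esub>\<close>.  Exponents may be 0.\<close>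

definition prime_factorizations :: "nat list \<Rightarrow> nat list \<Rightarrow> nat list list \<Rightarrow> bool" where
  "prime_factorizations a ps E \<longleftrightarrow>
     distinct ps \<and> (\<forall>p\<in>set ps. prime p) \<and>
     length E = length a \<and> (\<forall>es\<in>set E. length es = length ps) \<and>
     (\<forall>i<length a. a ! i = (\<Prod>j<length ps. ps ! j ^ (E ! i ! j)))"

definition instance_ok :: "nat list \<Rightarrow> nat list \<Rightarrow> nat list list \<Rightarrow> bool" where
  "instance_ok a ps E \<longleftrightarrow>
     (\<forall>x\<in>set a. x > 0) \<and> Gcd (set a) = 1 \<and>
     prime_factorizations a ps E \<and> (\<exists>I. noncoprime_sublist a I)"


section \<open>The posets and the Moebius function\<close>

text \<open>Posets are given by a carrier and an order relation on it, as in the library's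
  \<^const>\<open>partial_order_on\<close>.\<close>

definition roots_group :: "nat \<Rightarrow> complex set" where
  "roots_group f = {\<zeta>. \<zeta> ^ f = 1}"

definition P_tilde :: "int \<Rightarrow> nat list \<Rightarrow> complex set set" where
  "P_tilde d a = roots_group ` gcds_gt d a"

definition P_tilde_order :: "int \<Rightarrow> nat list \<Rightarrow> (complex set \<times> complex set) set" where
  "P_tilde_order d a = {(X, Y). X \<in> P_tilde d a \<and> Y \<in> P_tilde d a \<and> Y \<subseteq> X}"

text \<open>The added minimum of the poset is \<^const>\<open>None\<close>.\<close>

definition P_hat :: "int \<Rightarrow> nat list \<Rightarrow> complex set option set" where
  "P_hat d a = insert None (Some ` P_tilde d a)"

definition P_hat_order :: "int \<Rightarrow> nat list \<Rightarrow> (complex set option \<times> complex set option) set" where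
  "P_hat_order d a =
     {(None, y) | y. y \<in> P_hat d a} \<union> {(Some X, Some Y) | X Y. (X, Y) \<in> P_tilde_order d a}"

text \<open>The standard Moebius function of a finite poset; it is 0 on pairs that are not comparable,
  and the value 0 outside finite posets is only there to make the recursion total.\<close>

function poset_moebius :: "'x set \<Rightarrow> ('x \<times> 'x) set \<Rightarrow> 'x \<Rightarrow> 'x \<Rightarrow> int" where
  "poset_moebius A r x y =
     (if finite A \<and> partial_order_on A r \<and> x \<in> A \<and> y \<in> A then
        (if x = y then 1
         else if (x, y) \<in> r then
           - (\<Sum>z\<in>{z \<in> A. (x, z) \<in> r \<and> (z, y) \<in> r \<and> z \<noteq> y}. poset_moebius A r x z)
         else 0)
      else 0)"
  by pat_completeness auto
termination
proof (relation "Wellfounded.measure (\<lambda>(A, r, x, y). card {w \<in> A. (w, y) \<in> r})", simp, clarsimp)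
  fix A :: "'x set" and r :: "('x \<times> 'x) set" and x y z :: 'x
  assume fin: "finite A" and po: "partial_order_on A r" and y: "y \<in> A"
    and zy: "(z, y) \<in> r" "z \<noteq> y"
  note po' = partial_order_onD[OF po]
  have "{w \<in> A. (w, z) \<in> r} \<subseteq> {w \<in> A. (w, y) \<in> r}"
    using po'(2) zy(1) by (auto dest: transD)
  moreover have "(y, y) \<in> r" using po'(1) y by (auto dest: refl_onD)
  moreover have "(y, z) \<notin> r" using po'(3) zy by (auto dest: antisymD)
  ultimately have "{w \<in> A. (w, z) \<in> r} \<subset> {w \<in> A. (w, y) \<in> r}"
    using y by blast
  then show "card {w \<in> A. (w, z) \<in> r} < card {w \<in> A. (w, y) \<in> r}"
    using fin by (intro psubset_card_mono) auto
qed

declare poset_moebius.simps[simp del]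

definition mu :: "int \<Rightarrow> nat list \<Rightarrow> nat \<Rightarrow> int" where
  "mu d a f = - poset_moebius (P_hat d a) (P_hat_order d a) None (Some (roots_group f))"

definition fan :: "'x set \<Rightarrow> ('x \<times> 'x) set \<Rightarrow> 'x \<Rightarrow> bool" where
  "fan A r t \<longleftrightarrow> partial_order_on A r \<and> t \<in> A \<and> (\<forall>x\<in>A. (x, t) \<in> r) \<and>
     (\<forall>x\<in>A - {t}. \<forall>y\<in>A - {t}. x \<noteq> y \<longrightarrow> (x, y) \<notin> r)"


section \<open>Deterministic multitape Turing machines\<close>

text \<open>A machine has \<open>tapes\<close> two-way infinite tapes, the tape alphabet \<open>{..<symbols}\<close> with 0 as
  the blank, and the states \<open>{..states}\<close>; it starts in state 0 and the single halting
  state is \<open>states\<close>.  Only the restriction of \<open>delta\<close> to states and to symbol lists of the right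
  length matters, so the control is finite.\<close>

datatype move = Move_Left | Move_Stay | Move_Right

record turing_machine =
  tapes :: nat
  symbols :: nat
  states :: nat
  delta :: "nat \<Rightarrow> nat list \<Rightarrow> nat \<times> (nat \<times> move) list"

definition turing_machine_ok :: "turing_machine \<Rightarrow> bool" where
  "turing_machine_ok M \<longleftrightarrow>
     (\<forall>s<states M. \<forall>xs. length xs = tapes M \<and> set xs \<subseteq> {..<symbols M} \<longrightarrow>
        (case delta M s xs of (s', acts) \<Rightarrow>
           s' \<le> states M \<and> length acts = tapes M \<and> fst ` set acts \<subseteq> {..<symbols M}))"

text \<open>A tape is its content together with the position of its head.\<close>

type_synonym tape = "(int \<Rightarrow> nat) \<times> int"

type_synonym config = "nat \<times> tape list"

fun displacement :: "move \<Rightarrow> int" where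
  "displacement Move_Left = -1"
| "displacement Move_Stay = 0"
| "displacement Move_Right = 1"

fun tape_act :: "tape \<Rightarrow> nat \<times> move \<Rightarrow> tape" where
  "tape_act (c, h) (x, m) = (c(h := x), h + displacement m)"

fun tm_step :: "turing_machine \<Rightarrow> config \<Rightarrow> config" where
  "tm_step M (s, ts) =
     (if s = states M then (s, ts)
      else case delta M s (map (\<lambda>(c, h). c h) ts) of
             (s', acts) \<Rightarrow> (s', map2 tape_act ts acts))"

definition word_content :: "nat list \<Rightarrow> int \<Rightarrow> nat" where
  "word_content w = (\<lambda>k. if 0 \<le> k \<and> k < int (length w) then w ! nat k else 0)"

text \<open>Tape 0 carries the input and tape 1 the output; all heads start at position 0.\<close>

definition tm_init :: "turing_machine \<Rightarrow> nat list \<Rightarrow> config" where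
  "tm_init M w = (0, map (\<lambda>i. (if i = 0 then word_content w else (\<lambda>_. 0), 0)) [0..<tapes M])"

definition tm_outputs_within :: "turing_machine \<Rightarrow> nat list \<Rightarrow> nat \<Rightarrow> nat list \<Rightarrow> bool" where
  "tm_outputs_within M w t v \<longleftrightarrow>
     (\<exists>t'\<le>t. case (tm_step M ^^ t') (tm_init M w) of
               (s, ts) \<Rightarrow> s = states M \<and> fst (ts ! 1) = word_content v)"


section \<open>Encodings of input and output\<close>

abbreviation (input) sym_zero :: nat where "sym_zero \<equiv> 1"
abbreviation (input) sym_one :: nat where "sym_one \<equiv> 2"
abbreviation (input) sym_comma :: nat where "sym_comma \<equiv> 3"
abbreviation (input) sym_colon :: nat where "sym_colon \<equiv> 4"
abbreviation (input) sym_semicolon :: nat where "sym_semicolon \<equiv> 5"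

text \<open>Binary notation, most significant digit first.\<close>

fun binary :: "nat \<Rightarrow> nat list" where
  "binary n =
     (if n < 2 then [] else binary (n div 2)) @ [if even n then sym_zero else sym_one]"

declare binary.simps[simp del]

text \<open>The instance is written as
  \<open>p\<^sub>1,\<dots>,p\<^sub>n,;\<alpha>\<^sub>1:a\<^bsub>11\<^esub>,\<dots>,a\<^bsub>1n\<^esub>,;\<alpha>\<^sub>2:a\<^bsub>21\<^esub>,\<dots>,a\<^bsub>2n\<^esub>,;\<dots>\<close> with all numbers in binary.  The input size
  is the length of this word.\<close>

definition encode_numbers :: "nat list \<Rightarrow> nat list" where
  "encode_numbers xs = concat (map (\<lambda>x. binary x @ [sym_comma]) xs) @ [sym_semicolon]"

definition encode_instance :: "nat list \<Rightarrow> nat list \<Rightarrow> nat list list \<Rightarrow> nat list" where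
  "encode_instance a ps E =
     encode_numbers ps @
     concat (map (\<lambda>(x, es). binary x @ [sym_colon] @ encode_numbers es) (zip a E))"

definition input_size :: "nat list \<Rightarrow> nat list \<Rightarrow> nat list list \<Rightarrow> nat" where
  "input_size a ps E = length (encode_instance a ps E)"

text \<open>A sublist of a list of length \<open>N\<close> is written as its characteristic word of length \<open>N\<close>.\<close>

definition encode_sublists :: "nat \<Rightarrow> nat set list \<Rightarrow> nat list" where
  "encode_sublists N Is =
     concat (map (\<lambda>I. map (\<lambda>i. if i \<in> I then sym_one else sym_zero) [0..<N] @ [sym_semicolon]) Is)"

definition finds_largest_sublists_in_polynomial_time :: "turing_machine \<Rightarrow> bool" where
  "finds_largest_sublists_in_polynomial_time M \<longleftrightarrow>
     turing_machine_ok M \<and> tapes M \<ge> 2 \<and> symbols M > sym_semicolon \<and>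
     (\<exists>p :: nat poly. \<forall>a ps E. instance_ok a ps E \<longrightarrow>
        (\<exists>Is. set Is = largest_sublists a \<and>
           tm_outputs_within M (encode_instance a ps E) (poly p (input_size a ps E))
             (encode_sublists (length a) Is)))"

end

theory Submission
  imports Defs
begin

text \<open>By unique factorization, a nonempty sublist has a common factor iff it is contained in the set
  \<open>S\<^sub>j\<close> of the positions where the \<open>j\<close>-th exponent is positive, for some \<open>j\<close>.  Hence the largest such
  sublists are the \<open>S\<^sub>j\<close> of maximum cardinality, and there are at most \<open>n\<close> of them.  If \<open>f\<close>
  divides \<open>g\<close>, where \<open>f, g \<noteq> 1\<close> are the gcds of sublists \<open>I\<close> and \<open>J\<close> of maximum size \<open>\<ell>\<close>, then \<open>f\<close>
  divides all entries at \<open>I \<union> J\<close>; so \<open>I \<union> J\<close> has size at most \<open>\<ell>\<close>, and \<open>I = J\<close> and \<open>f = g\<close>.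

  The Turing machine makes two passes over the exponent matrix, each scanning the whole input
  once per column.  In both passes the head of a counter tape moves one cell to the right, writing
  a 1, for every nonzero exponent of the current column.  After the first pass the tape therefore
  holds the maximum of the column counts in unary, and in the second pass a column attains
  the maximum iff the counter head ends on a blank.  The characteristic words of the columns are
  written out during the second pass, and those of the other columns are erased again.\<close>

section \<open>The machine\<close>

text \<open>The first flag of a phase is true in the second pass.  \<open>Rew\<close> rewinds the input and the counter
  tape, \<open>Skip\<close> skips the list of primes, \<open>Row\<close> looks for the colon that ends \<open>\<alpha>\<^sub>i\<close>,
  \<open>Fld\<close> is the start of an exponent, \<open>Num\<close> is inside an exponent, the second flag telling whether it
  is nonzero, \<open>Rest\<close> skips the remaining exponents of the row, and \<open>Erase\<close> deletes the last word on
  the output tape.\<close>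

datatype phase = Rew bool | Skip bool | Row bool | Fld bool | Num bool bool | Rest bool | Erase | Halt

text \<open>The starting phase must get code 0 and \<open>Halt\<close> the largest code. The start
  is \<open>Skip False\<close>: all heads begin at position 0, so no rewinding is due.\<close>

fun phase_code :: "phase \<Rightarrow> nat" where
  "phase_code (Skip b) = of_bool b"
| "phase_code (Rew b) = 2 + of_bool b"
| "phase_code (Row b) = 4 + of_bool b"
| "phase_code (Fld b) = 6 + of_bool b"
| "phase_code (Num b c) = 8 + 2 * of_bool b + of_bool c"
| "phase_code (Rest b) = 12 + of_bool b"
| "phase_code Erase = 14"
| "phase_code Halt = 15"

lemma inj_phase_code: "inj phase_code"
proof (rule injI)
  fix p q show "phase_code p = phase_code q \<Longrightarrow> p = q"
    by (cases p; cases q) (auto simp: of_bool_def split: if_splits)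
qed

lemma phase_code_le: "phase_code q \<le> 15"
  by (cases q) (auto simp: of_bool_def)

text \<open>The columns are consumed one by one: when a scan reads an exponent it toggles the separator
  after it between the comma and the extra symbol 6.  Thus the first pass leaves the input tape in
  the initial state of the second pass.\<close>

definition pending :: "bool \<Rightarrow> nat" where
  "pending b = (if b then 6 else sym_comma)"

abbreviation visited :: "bool \<Rightarrow> nat" where
  "visited b \<equiv> pending (\<not> b)"

text \<open>\<open>x\<close>, \<open>y\<close>, \<open>z\<close> are the symbols scanned on the
  input, output and counter tapes. A blank met in \<open>Row\<close> ends a scan; a semicolon met in
  \<open>Fld\<close> means that no column is left, which ends the pass.\<close>

fun trans_fun :: "phase \<Rightarrow> nat \<Rightarrow> nat \<Rightarrow> nat \<Rightarrow> phase \<times> (nat \<times> move) \<times> (nat \<times> move) \<times> (nat \<times> move)" where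
  "trans_fun (Rew b) x y z =
     (if x = 0 \<and> z = 0 then (Skip b, (x, Move_Right), (y, Move_Stay), (z, Move_Right))
      else (Rew b, (x, if x = 0 then Move_Stay else Move_Left), (y, Move_Stay),
              (z, if z = 0 then Move_Stay else Move_Left)))"
| "trans_fun (Skip b) x y z =
     (if x = sym_semicolon then Row b else Skip b, (x, Move_Right), (y, Move_Stay), (z, Move_Stay))"
| "trans_fun (Row b) x y z =
     (if x = 0 then
        if \<not> b then (Rew b, (x, Move_Left), (y, Move_Stay), (z, Move_Left))
        else if z = 0 then (Rew b, (x, Move_Left), (sym_semicolon, Move_Right), (z, Move_Left))
        else (Erase, (x, Move_Stay), (y, Move_Left), (z, Move_Stay))
      else (if x = sym_colon then Fld b else Row b, (x, Move_Right), (y, Move_Stay), (z, Move_Stay)))"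
| "trans_fun (Fld b) x y z =
     (if x = sym_semicolon then
        if b then (Halt, (x, Move_Stay), (y, Move_Stay), (z, Move_Stay))
        else (Rew True, (x, Move_Left), (y, Move_Stay), (z, Move_Left))
      else (Num b (x = sym_one), (x, Move_Right), (y, Move_Stay), (z, Move_Stay)))"
| "trans_fun (Num b c) x y z =
     (if x = pending b then
        (Rest b, (visited b, Move_Right),
           if b then (if c then sym_one else sym_zero, Move_Right) else (y, Move_Stay),
           if c then (1, Move_Right) else (z, Move_Stay))
      else (if x = visited b then Fld b else Num b c,
              (x, Move_Right), (y, Move_Stay), (z, Move_Stay)))"
| "trans_fun (Rest b) x y z =
     (if x = sym_semicolon then Row b else Rest b, (x, Move_Right), (y, Move_Stay), (z, Move_Stay))"
| "trans_fun Erase x y z =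
     (if y = sym_zero \<or> y = sym_one then (Erase, (x, Move_Stay), (0, Move_Left), (z, Move_Stay))
      else (Rew True, (x, Move_Left), (y, Move_Right), (z, Move_Left)))"
| "trans_fun Halt x y z = (Halt, (x, Move_Stay), (y, Move_Stay), (z, Move_Stay))"

definition finder :: turing_machine where
  "finder = \<lparr>tapes = 3, symbols = 7, states = 15,
     delta = (\<lambda>s xs. case trans_fun (inv phase_code s) (xs ! 0) (xs ! 1) (xs ! 2) of
               (q, \<alpha>, \<beta>, \<gamma>) \<Rightarrow> (phase_code q, [\<alpha>, \<beta>, \<gamma>]))\<rparr>"

lemma trans_fun_symbols:
  assumes "trans_fun q x y z = (q', \<alpha>, \<beta>, \<gamma>)" and "x < 7" "y < 7" "z < 7"
  shows "fst \<alpha> < 7 \<and> fst \<beta> < 7 \<and> fst \<gamma> < 7"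
  using assms by (cases q) (auto simp: pending_def split: if_splits)

lemma turing_machine_ok_finder: "turing_machine_ok finder"
  unfolding turing_machine_ok_def
proof (intro allI impI)
  fix s xs
  assume xs: "length xs = tapes finder \<and> set xs \<subseteq> {..<symbols finder}"
  then obtain x y z where xyz: "xs = [x, y, z]" "x < 7" "y < 7" "z < 7"
    by (auto simp: finder_def numeral_3_eq_3 length_Suc_conv)
  obtain q \<alpha> \<beta> \<gamma> where q: "trans_fun (inv phase_code s) x y z = (q, \<alpha>, \<beta>, \<gamma>)"
    by (cases "trans_fun (inv phase_code s) x y z")
  show "case delta finder s xs of (s', acts) \<Rightarrow>
           s' \<le> states finder \<and> length acts = tapes finder \<and> fst ` set acts \<subseteq> {..<symbols finder}"
    using trans_fun_symbols[OF q xyz(2-4)] phase_code_le[of q] q xyz(1) by (simp add: finder_def)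
qed

declare tape_act.simps [simp del]

type_synonym conf = "phase \<times> tape \<times> tape \<times> tape"

abbreviation scanned :: "tape \<Rightarrow> nat" where
  "scanned t \<equiv> fst t (snd t)"

text \<open>Simulates \<open>finder\<close> with phases instead of state numbers and with three
  separate tapes, so that single steps can be computed by rewriting.\<close>

fun step :: "conf \<Rightarrow> conf" where
  "step (q, r, s, t) = (case trans_fun q (scanned r) (scanned s) (scanned t) of
     (q', \<alpha>, \<beta>, \<gamma>) \<Rightarrow> (q', tape_act r \<alpha>, tape_act s \<beta>, tape_act t \<gamma>))"

fun config_of :: "conf \<Rightarrow> config" where
  "config_of (q, r, s, t) = (phase_code q, [r, s, t])"

lemma tape_act_scanned: "scanned t = y \<Longrightarrow> tape_act t (y, m) = (fst t, snd t + displacement m)"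
  by (cases t) (auto simp: tape_act.simps)

lemma tape_act_stay [simp]: "scanned t = y \<Longrightarrow> tape_act t (y, Move_Stay) = t"
  by (simp add: tape_act_scanned)

lemma tape_act_left [simp]: "scanned t = y \<Longrightarrow> tape_act t (y, Move_Left) = (fst t, snd t - 1)"
  by (simp add: tape_act_scanned)

text \<open>Outside \<open>Halt\<close>, injectivity of the coding recovers the phase; in
  \<open>Halt\<close> the machine stands still and \<open>step\<close> writes back what it
  scans.\<close>

lemma tm_step_finder: "tm_step finder (config_of c) = config_of (step c)"
proof -
  obtain q r s t where c: "c = (q, r, s, t)" by (cases c)
  show ?thesis
  proof (cases "q = Halt")
    case True
    then show ?thesis by (simp add: c finder_def)
  next
    case False
    then have "phase_code q \<noteq> 15"
      using inj_phase_code by (metis phase_code.simps(8) injD)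
    then show ?thesis
      by (simp add: c finder_def inv_f_f[OF inj_phase_code] case_prod_beta split: prod.split)
  qed
qed

lemma funpow_tm_step_finder: "(tm_step finder ^^ k) (config_of c) = config_of ((step ^^ k) c)"
  by (induction k) (simp_all add: tm_step_finder)

section \<open>Runs of the machine\<close>

text \<open>Only an upper bound on the number of steps is kept, so bounds add up along a run and can
  be rounded up.\<close>

definition reach :: "nat \<Rightarrow> conf \<Rightarrow> conf \<Rightarrow> bool" where
  "reach n c d \<longleftrightarrow> (\<exists>k\<le>n. (step ^^ k) c = d)"

lemma reach_refl: "reach n c c"
  unfolding reach_def by (rule exI[of _ 0]) simp

lemma reach_mono: "reach m c d \<Longrightarrow> m \<le> n \<Longrightarrow> reach n c d"
  unfolding reach_def using le_trans by blast

lemma reach_trans: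
  assumes "reach m c d" "reach n d e"
  shows "reach (m + n) c e"
proof -
  obtain k l where "k \<le> m" "(step ^^ k) c = d" "l \<le> n" "(step ^^ l) d = e"
    using assms by (auto simp: reach_def)
  then have "l + k \<le> m + n" "(step ^^ (l + k)) c = e"
    by (simp_all add: funpow_add)
  then show ?thesis
    unfolding reach_def by blast
qed

lemma reach_step: "reach n (step c) d \<Longrightarrow> reach (Suc n) c d"
  unfolding reach_def by (metis Suc_le_mono comp_apply funpow_Suc_right)

text \<open>A word split at the head: \<open>v\<close> starts with the scanned symbol, and for empty
  \<open>v\<close> the head is on the blank cell just after \<open>u\<close>.\<close>

definition tape_at :: "nat list \<Rightarrow> nat list \<Rightarrow> tape" where
  "tape_at u v = (word_content (u @ v), int (length u))"

lemma word_content_outside: "h < 0 \<or> h \<ge> int (length w) \<Longrightarrow> word_content w h = 0"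
  by (auto simp: word_content_def)

lemma word_content_eq_0_iff:
  "0 \<notin> set w \<Longrightarrow> word_content w h = 0 \<longleftrightarrow> h < 0 \<or> h \<ge> int (length w)"
  by (auto simp: word_content_def in_set_conv_nth nat_less_iff)

lemma word_content_upd: "(word_content (u @ x # v))(int (length u) := y) = word_content (u @ y # v)"
  by (auto simp: word_content_def nth_append fun_eq_iff)

lemma word_content_upd_end: "(word_content u)(int (length u) := y) = word_content (u @ [y])"
  by (auto simp: word_content_def nth_append fun_eq_iff)

text \<open>Contents are padded with blanks, so writing a blank over the last symbol really shortens
  the word.\<close>

lemma word_content_snoc_0: "word_content (u @ [0]) = word_content u"
  by (auto simp: word_content_def nth_append fun_eq_iff)

lemma scanned_tape_at [simp]: "scanned (tape_at u (x # v)) = x" "scanned (tape_at u []) = 0"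
  by (simp_all add: tape_at_def word_content_def)

lemma tape_act_tape_at [simp]:
  "tape_act (tape_at u (x # v)) (y, Move_Right) = tape_at (u @ [y]) v"
  "tape_act (tape_at u []) (y, Move_Right) = tape_at (u @ [y]) []"
  by (simp_all add: tape_at_def tape_act.simps word_content_upd word_content_upd_end)

lemma binary_digits: "set (binary n) \<subseteq> {sym_zero, sym_one}"
  by (induction n rule: binary.induct) (subst binary.simps, auto)

text \<open>The leading digit alone tells whether the number is 0, so the machine knows the flag of
  \<open>Num\<close> after one symbol.\<close>

lemma binary_Cons:
  obtains w where "binary n = (if n = 0 then sym_zero else sym_one) # w"
proof -
  have "\<exists>w. binary n = (if n = 0 then sym_zero else sym_one) # w"
  proof (induction n rule: binary.induct)
    case (1 n)
    show ?case
    proof (cases "n < 2")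
      case True
      then have "n = 0 \<or> n = 1" by auto
      then show ?thesis by (subst binary.simps) auto
    next
      case False
      then have "n \<noteq> 0" "n div 2 \<noteq> 0" by auto
      with 1[OF False] False show ?thesis
        by (subst binary.simps) auto
    qed
  qed
  with that show ?thesis by blast
qed

lemma binary_subset: "x \<in> set (binary n) \<Longrightarrow> x = sym_zero \<or> x = sym_one"
  using binary_digits by auto

section \<open>Scanning one row of the input\<close>

lemma skip_run:
  "sym_semicolon \<notin> set w \<Longrightarrow>
    reach (Suc (length w)) (Skip b, tape_at u (w @ sym_semicolon # v), s, t)
      (Row b, tape_at (u @ w @ [sym_semicolon]) v, s, t)"
proof (induction w arbitrary: u)
  case Nil
  show ?case by (rule reach_step) (simp add: reach_refl)
next
  case (Cons x w)
  then show ?case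
    using Cons.IH[of "u @ [x]"] by (auto intro: reach_step)
qed

lemma rest_run:
  "sym_semicolon \<notin> set w \<Longrightarrow>
    reach (Suc (length w)) (Rest b, tape_at u (w @ sym_semicolon # v), s, t)
      (Row b, tape_at (u @ w @ [sym_semicolon]) v, s, t)"
proof (induction w arbitrary: u)
  case Nil
  show ?case by (rule reach_step) (simp add: reach_refl)
next
  case (Cons x w)
  then show ?case
    using Cons.IH[of "u @ [x]"] by (auto intro: reach_step)
qed

lemma row_run:
  "0 \<notin> set w \<Longrightarrow> sym_colon \<notin> set w \<Longrightarrow>
    reach (Suc (length w)) (Row b, tape_at u (w @ sym_colon # v), s, t)
      (Fld b, tape_at (u @ w @ [sym_colon]) v, s, t)"
proof (induction w arbitrary: u)
  case Nil
  show ?case by (rule reach_step) (simp add: reach_refl)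
next
  case (Cons x w)
  then show ?case
    using Cons.IH[of "u @ [x]"] by (auto intro: reach_step)
qed

lemma num_run:
  "set w \<subseteq> {sym_zero, sym_one} \<Longrightarrow>
    reach (length w) (Num b c, tape_at u (w @ v), s, t) (Num b c, tape_at (u @ w) v, s, t)"
proof (induction w arbitrary: u)
  case Nil
  show ?case by (simp add: reach_refl)
next
  case (Cons x w)
  then show ?case
    using Cons.IH[of "u @ [x]"] by (auto simp: pending_def intro!: reach_step)
qed

text \<open>The first digit sets the flag according to \<open>binary_Cons\<close>, and
  \<open>num_run\<close> carries it over the remaining digits.\<close>

lemma fld_run:
  "reach (length (binary e)) (Fld b, tape_at u (binary e @ v), s, t)
     (Num b (e \<noteq> 0), tape_at (u @ binary e) v, s, t)"
proof -
  obtain w where w: "binary e = (if e = 0 then sym_zero else sym_one) # w"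
    by (rule binary_Cons)
  have "set w \<subseteq> {sym_zero, sym_one}"
    using binary_digits[of e] by (simp add: w)
  from num_run[OF this, of b "e \<noteq> 0" "u @ [if e = 0 then sym_zero else sym_one]" v s t]
  show ?thesis
    by (auto simp: w intro!: reach_step)
qed

definition fields :: "nat \<Rightarrow> nat list \<Rightarrow> nat list" where
  "fields x es = concat (map (\<lambda>e. binary e @ [x]) es)"

lemma fields_simps [simp]:
  "fields x [] = []" "fields x (e # es) = binary e @ x # fields x es"
  "fields x (es @ es') = fields x es @ fields x es'"
  by (simp_all add: fields_def)

lemma set_fields: "set (fields x es) \<subseteq> {sym_zero, sym_one, x}"
  by (auto simp: fields_def dest: binary_subset)

text \<open>A visited separator sends \<open>Num\<close> back to \<open>Fld\<close>, so consumed
  exponents are passed over without any effect on the tapes.\<close>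

lemma visited_run:
  "reach (length (fields (visited b) es)) (Fld b, tape_at u (fields (visited b) es @ v), s, t)
     (Fld b, tape_at (u @ fields (visited b) es) v, s, t)"
proof (induction es arbitrary: u)
  case Nil
  show ?case by (simp add: reach_refl)
next
  case (Cons e es)
  have "reach 1 (Num b (e \<noteq> 0), tape_at (u @ binary e) (visited b # fields (visited b) es @ v), s, t)
     (Fld b, tape_at (u @ binary e @ [visited b]) (fields (visited b) es @ v), s, t)"
    by (auto simp: pending_def intro!: reach_step reach_refl)
  from reach_trans[OF reach_trans[OF fld_run this] Cons.IH] show ?case
    by simp
qed

text \<open>The encoding of a row after \<open>j\<close> columns have been consumed.\<close>

definition row_word :: "bool \<Rightarrow> nat \<Rightarrow> nat \<times> nat list \<Rightarrow> nat list" where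
  "row_word b j = (\<lambda>(x, es). binary x @ sym_colon # fields (visited b) (take j es) @
     fields (pending b) (drop j es) @ [sym_semicolon])"

text \<open>The counter tape with its head at position \<open>c\<close>, when the largest column count met before is \<open>m\<close>.\<close>

definition counter :: "nat \<Rightarrow> nat \<Rightarrow> tape" where
  "counter m c = (word_content (replicate (max m c) 1), int c)"

text \<open>Before position \<open>m\<close> a 1 is overwritten by a 1; from there on the block of
  ones grows. The tape thus maintains a running maximum with no comparison being made.\<close>

lemma tape_act_counter [simp]: "tape_act (counter m c) (1, Move_Right) = counter m (Suc c)"
proof (cases "c < m")
  case True
  then have "(word_content (replicate m 1))(int c := 1) = word_content (replicate m 1)"
    by (auto simp: word_content_def fun_eq_iff)
  with True show ?thesis by (simp add: counter_def tape_act.simps)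
next
  case False
  then show ?thesis
    using word_content_upd_end[of "replicate c 1" 1]
    by (simp add: counter_def tape_act.simps replicate_append_same max_def)
qed

lemma scanned_counter: "c \<le> m \<Longrightarrow> scanned (counter m c) = (if c = m then 0 else 1)"
  by (simp add: counter_def word_content_def)

definition bit_symbol :: "bool \<Rightarrow> nat" where
  "bit_symbol c = (if c then sym_one else sym_zero)"

text \<open>The row is cut into the number before the colon, the visited fields, the exponent of
  column \<open>j\<close> and the remaining fields. Every step moves the input head one cell to the
  right, so the time is the length of the row.\<close>

lemma row_word_run:
  assumes "j < length es"
  shows "reach (length (row_word b j (x, es)))
     (Row b, tape_at u (row_word b j (x, es) @ v), tape_at w [], counter m c)
     (Row b, tape_at (u @ row_word b (Suc j) (x, es)) v,
        tape_at (w @ (if b then [bit_symbol (es ! j \<noteq> 0)] else [])) [],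
        counter m (c + of_bool (es ! j \<noteq> 0)))"
proof -
  let ?f = "fields (visited b) (take j es)" and ?g = "fields (pending b) (drop (Suc j) es)"
  let ?e = "es ! j"
  have drop: "drop j es = ?e # drop (Suc j) es" and take: "take (Suc j) es = take j es @ [?e]"
    using assms by (simp_all add: Cons_nth_drop_Suc take_Suc_conv_app_nth)
  let ?v3 = "?g @ sym_semicolon # v"
  let ?v2 = "binary ?e @ pending b # ?v3"
  let ?s' = "tape_at (w @ (if b then [bit_symbol (?e \<noteq> 0)] else [])) []"
  let ?t = "counter m c" and ?t' = "counter m (c + of_bool (?e \<noteq> 0))"
  let ?u1 = "u @ binary x @ [sym_colon]"
  have 1: "reach (Suc (length (binary x)))
      (Row b, tape_at u (binary x @ sym_colon # ?f @ ?v2), tape_at w [], ?t)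
      (Fld b, tape_at ?u1 (?f @ ?v2), tape_at w [], ?t)"
    using binary_digits[of x] by (intro row_run) auto
  have 2: "reach (length ?f) (Fld b, tape_at ?u1 (?f @ ?v2), tape_at w [], ?t)
      (Fld b, tape_at (?u1 @ ?f) ?v2, tape_at w [], ?t)"
    by (rule visited_run)
  have 3: "reach (length (binary ?e)) (Fld b, tape_at (?u1 @ ?f) ?v2, tape_at w [], ?t)
      (Num b (?e \<noteq> 0), tape_at ((?u1 @ ?f) @ binary ?e) (pending b # ?v3), tape_at w [], ?t)"
    by (rule fld_run)
  \<comment> \<open>The only step that changes the tapes: it toggles the separator, writes the digit
    in the second pass and moves the counter head for a nonzero exponent.\<close>
  have 4: "reach 1
      (Num b (?e \<noteq> 0), tape_at ((?u1 @ ?f) @ binary ?e) (pending b # ?v3), tape_at w [], ?t)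
      (Rest b, tape_at (((?u1 @ ?f) @ binary ?e) @ [visited b]) ?v3, ?s', ?t')"
    by (auto simp: bit_symbol_def tape_act_counter[unfolded One_nat_def] intro!: reach_step reach_refl)
  have 5: "reach (Suc (length ?g))
      (Rest b, tape_at (((?u1 @ ?f) @ binary ?e) @ [visited b]) ?v3, ?s', ?t')
      (Row b, tape_at ((((?u1 @ ?f) @ binary ?e) @ [visited b]) @ ?g @ [sym_semicolon]) v, ?s', ?t')"
    using set_fields[of "pending b" "drop (Suc j) es"]
    by (intro rest_run) (auto simp: pending_def split: if_splits)
  from reach_trans[OF 1 reach_trans[OF 2 reach_trans[OF 3 reach_trans[OF 4 5]]]]
  show ?thesis
    by (simp add: row_word_def drop take)
qed

section \<open>Scanning all rows, rewinding and erasing\<close>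

definition column_count :: "(nat \<times> nat list) list \<Rightarrow> nat \<Rightarrow> nat" where
  "column_count rs j = length (filter (\<lambda>(x, es). es ! j \<noteq> 0) rs)"

definition column_word :: "(nat \<times> nat list) list \<Rightarrow> nat \<Rightarrow> nat list" where
  "column_word rs j = map (\<lambda>(x, es). bit_symbol (es ! j \<noteq> 0)) rs"

lemma rows_run:
  assumes "\<forall>(x, es)\<in>set rs. j < length es"
  shows "reach (length (concat (map (row_word b j) rs)))
     (Row b, tape_at u (concat (map (row_word b j) rs)), tape_at w [], counter m c)
     (Row b, tape_at (u @ concat (map (row_word b (Suc j)) rs)) [],
        tape_at (w @ (if b then column_word rs j else [])) [],
        counter m (c + column_count rs j))"
  using assms
proof (induction rs arbitrary: u w c)
  case Nil
  show ?case by (simp add: column_word_def column_count_def reach_refl)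
next
  case (Cons r rs)
  obtain x es where r: "r = (x, es)" by (cases r)
  have "j < length es" using Cons.prems by (simp add: r)
  note 1 = row_word_run[OF this, of b x u "concat (map (row_word b j) rs)" w m c]
  have "\<forall>(x, es)\<in>set rs. j < length es" using Cons.prems by simp
  from reach_trans[OF 1 Cons.IH[OF this]] show ?case
    by (cases b) (auto simp: r column_word_def column_count_def add.assoc)
qed

text \<open>Both heads go left together, and the one that first meets the blank at position -1 waits
  for the other. The words contain no blank, so no head stops earlier; \<open>k = 0\<close> or
  \<open>l = 0\<close> describes a waiting head.\<close>

lemma rewind_run:
  assumes "0 \<notin> set u" "0 \<notin> set v" "k \<le> n" "l \<le> n" "k \<le> length u" "l \<le> length v"
  shows "reach (Suc n) (Rew b, (word_content u, int k - 1), s, (word_content v, int l - 1))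
           (Skip b, (word_content u, 0), s, (word_content v, 0))"
  using assms(3-6)
proof (induction n arbitrary: k l)
  case 0
  then have "k = 0" "l = 0" by auto
  then show ?case
    by (intro reach_step) (simp add: word_content_outside tape_act_scanned reach_refl)
next
  case (Suc n)
  \<comment> \<open>Truncated subtraction models the waiting: for \<open>k = 0\<close> the position
    stays -1.\<close>
  have "reach (Suc n) (Rew b, (word_content u, int (k - 1) - 1), s, (word_content v, int (l - 1) - 1))
           (Skip b, (word_content u, 0), s, (word_content v, 0))"
    using Suc.prems by (intro Suc.IH) auto
  moreover have "step (Rew b, (word_content u, int k - 1), s, (word_content v, int l - 1)) =
     (if k = 0 \<and> l = 0 then (Skip b, (word_content u, 0), s, (word_content v, 0))
      else (Rew b, (word_content u, int (k - 1) - 1), s, (word_content v, int (l - 1) - 1)))"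
    using Suc.prems assms(1,2)
    by (auto simp: word_content_eq_0_iff of_nat_diff tape_act_scanned)
  ultimately show ?case
    by (intro reach_step[of "Suc n"]) (simp only: reach_refl simp_thms split: if_split)
qed

text \<open>The symbols disappear from the right, hence the reversed induction. Erasing stops at the
  semicolon of the preceding word, or at the blank left of position 0 if \<open>w\<close> is
  empty.\<close>

lemma erase_run:
  assumes "w = [] \<or> last w = sym_semicolon" "set x \<subseteq> {sym_zero, sym_one}"
  shows "reach (Suc (length x))
     (Erase, r, (word_content (w @ x), int (length (w @ x)) - 1), t)
     (Rew True, (fst r, snd r - 1), tape_at w [], (fst t, snd t - 1))"
  using assms(2)
proof (induction x rule: rev_induct)
  case Nil
  show ?case
    using assms(1)
    by (intro reach_step, cases w rule: rev_cases)
      (auto simp: tape_at_def tape_act_scanned word_content_def nth_append add.commute reach_refl)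
next
  case (snoc y x)
  have "(word_content (w @ x @ [y]))(int (length (w @ x)) := 0) = word_content (w @ x)"
    using word_content_upd[of "w @ x" y "[]" 0] word_content_snoc_0[of "w @ x"] by simp
  moreover have "word_content (w @ x @ [y]) (int (length (w @ x))) = y"
    by (simp add: word_content_def nth_append flip: of_nat_add)
  ultimately show ?case
    using snoc by (intro reach_step) (auto simp: tape_act.simps)
qed

section \<open>Consuming one column per scan\<close>

definition pass_word :: "nat list \<Rightarrow> bool \<Rightarrow> nat \<Rightarrow> (nat \<times> nat list) list \<Rightarrow> nat list" where
  "pass_word ps b j rs = encode_numbers ps @ concat (map (row_word b j) rs)"

definition start_conf ::
    "nat list \<Rightarrow> bool \<Rightarrow> nat \<Rightarrow> (nat \<times> nat list) list \<Rightarrow> nat list \<Rightarrow> nat \<Rightarrow> conf" where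
  "start_conf ps b j rs w m = (Skip b, tape_at [] (pass_word ps b j rs), tape_at w [], counter m 0)"

lemma encode_numbers_fields: "encode_numbers xs = fields sym_comma xs @ [sym_semicolon]"
  by (simp add: encode_numbers_def fields_def)

lemma length_fields: "length (fields x es) = length (fields 0 es)"
  by (induction es) simp_all

lemma length_row_word: "length (row_word b j (x, es)) = length (binary x) + length (fields 0 es) + 2"
proof -
  have "length (fields (visited b) (take j es)) + length (fields (pending b) (drop j es)) =
      length (fields 0 (take j es @ drop j es))"
    using length_fields[of "visited b" "take j es"] length_fields[of "pending b" "drop j es"]
    by (simp only: fields_simps length_append)
  then show ?thesis
    by (simp add: row_word_def)
qed

text \<open>Toggling separators preserves the length, so one number bounds all scans of both
  passes.\<close>

lemma length_pass_word: "length (pass_word ps b j rs) = length (pass_word ps False 0 rs)"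
  unfolding pass_word_def by (induction rs) (auto simp: length_row_word)

lemma length_rows_le: "length rs \<le> length (pass_word ps b j rs)"
  unfolding pass_word_def by (induction rs) (auto simp: length_row_word)

lemma column_count_le: "column_count rs j \<le> length rs"
  by (simp add: column_count_def)

lemma zero_notin_pass_word: "0 \<notin> set (pass_word ps b j rs)"
proof -
  have *: "0 \<notin> set (fields x es)" if "x \<noteq> 0" for x es
    using set_fields[of x es] that by auto
  have "0 \<notin> set (row_word b j (x, es))" for x es
    using binary_digits[of x] by (auto simp: row_word_def * pending_def)
  then show ?thesis
    by (auto simp: pass_word_def encode_numbers_fields *)
qed

lemma scan_run:
  assumes "\<forall>(x, es)\<in>set rs. j < length es"
  shows "reach (length (pass_word ps b j rs)) (start_conf ps b j rs w m)
     (Row b, tape_at (pass_word ps b (Suc j) rs) [],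
        tape_at (w @ (if b then column_word rs j else [])) [], counter m (column_count rs j))"
proof -
  have "sym_semicolon \<notin> set (fields sym_comma ps)"
    using set_fields[of sym_comma ps] by auto
  from reach_trans[OF skip_run[OF this, of b "[]"] rows_run[OF assms, of b _ w m 0]]
  show ?thesis
    by (simp add: start_conf_def pass_word_def encode_numbers_fields)
qed

text \<open>The ones written on the counter tape survive the rewinding, so going back to position 0
  is all that updating the maximum requires.\<close>

lemma rewind_start:
  assumes "k \<le> length (pass_word ps b j rs)" "c \<le> length (pass_word ps b j rs)"
  shows "reach (Suc (length (pass_word ps b j rs)))
     (Rew b, (word_content (pass_word ps b j rs), int k - 1), tape_at w [],
        (fst (counter m c), snd (counter m c) - 1))
     (start_conf ps b j rs w (max m c))"
  using rewind_run[OF zero_notin_pass_word, of "replicate (max m c) 1" k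
      "length (pass_word ps b j rs)" c ps b j rs b "tape_at w []"] assms
  by (simp add: start_conf_def tape_at_def counter_def)

lemma find_max_column:
  assumes "\<forall>(x, es)\<in>set rs. j < length es"
  shows "reach (3 * length (pass_word ps False 0 rs) + 3) (start_conf ps False j rs w m)
     (start_conf ps False (Suc j) rs w (max m (column_count rs j)))"
proof -
  let ?W = "pass_word ps False (Suc j) rs" and ?c = "column_count rs j"
  have c: "?c \<le> length ?W"
    using column_count_le length_rows_le le_trans by blast
  have 1: "reach (length ?W) (start_conf ps False j rs w m)
      (Row False, tape_at ?W [], tape_at w [], counter m ?c)"
    using scan_run[OF assms, of ps False w m]
    by (simp add: length_pass_word[of ps False j] length_pass_word[of ps False "Suc j"])
  have 2: "reach 1 (Row False, tape_at ?W [], tape_at w [], counter m ?c)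
      (Rew False, (word_content ?W, int (length ?W) - 1), tape_at w [],
        (fst (counter m ?c), snd (counter m ?c) - 1))"
    unfolding One_nat_def
    by (rule reach_step) (simp add: reach_refl tape_at_def[of ?W] word_content_outside)
  note 3 = rewind_start[OF order.refl c]
  from reach_trans[OF 1 reach_trans[OF 2 3]] show ?thesis
    by (rule reach_mono) (simp add: length_pass_word[of ps False "Suc j"])
qed

text \<open>As the count is at most \<open>m\<close>, the counter head ends on a blank exactly if
  the count equals \<open>m\<close>. The bound adds up a scan, a possible erasure and a
  rewinding.\<close>

lemma output_column:
  assumes "\<forall>(x, es)\<in>set rs. j < length es" "column_count rs j \<le> m"
    and w: "w = [] \<or> last w = sym_semicolon"
  shows "reach (3 * length (pass_word ps False 0 rs) + 3) (start_conf ps True j rs w m)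
     (start_conf ps True (Suc j) rs
        (w @ (if column_count rs j = m then column_word rs j @ [sym_semicolon] else [])) m)"
proof -
  let ?W = "pass_word ps True (Suc j) rs" and ?c = "column_count rs j" and ?x = "column_word rs j"
  have c: "?c \<le> length ?W"
    using column_count_le length_rows_le le_trans by blast
  have len: "length ?x \<le> length ?W"
    using length_rows_le[of rs ps True "Suc j"] by (simp add: column_word_def)
  have m: "max m ?c = m" using assms(2) by simp
  have 1: "reach (length ?W) (start_conf ps True j rs w m)
      (Row True, tape_at ?W [], tape_at (w @ ?x) [], counter m ?c)"
    using scan_run[OF assms(1), of ps True w m]
    by (simp add: length_pass_word[of ps True j] length_pass_word[of ps True "Suc j"])
  let ?left = "\<lambda>t. (fst t, snd t - 1)"
  let ?w' = "w @ (if ?c = m then ?x @ [sym_semicolon] else [])"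
  have 2: "reach (length ?W + 2) (Row True, tape_at ?W [], tape_at (w @ ?x) [], counter m ?c)
      (Rew True, ?left (tape_at ?W []), tape_at ?w' [], ?left (counter m ?c))"
  proof (cases "?c = m")
    case True
    have "reach 1 (Row True, tape_at ?W [], tape_at (w @ ?x) [], counter m ?c)
      (Rew True, ?left (tape_at ?W []), tape_at ?w' [], ?left (counter m ?c))"
      unfolding One_nat_def
      by (rule reach_step) (auto simp: reach_refl True scanned_counter)
    then show ?thesis
      by (rule reach_mono) simp
  next
    case False
    have "set ?x \<subseteq> {sym_zero, sym_one}"
      by (auto simp: column_word_def bit_symbol_def split: if_splits)
    note e = erase_run[OF w this, of "tape_at ?W []" "counter m ?c"]
    have "reach (Suc (Suc (length ?x))) (Row True, tape_at ?W [], tape_at (w @ ?x) [], counter m ?c)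
      (Rew True, ?left (tape_at ?W []), tape_at ?w' [], ?left (counter m ?c))"
      by (rule reach_step) (use e False assms(2) in \<open>simp add: scanned_counter tape_at_def[of "w @ _"]\<close>)
    then show ?thesis
      by (rule reach_mono) (use len in simp)
  qed
  have 3: "reach (Suc (length ?W)) (Rew True, ?left (tape_at ?W []), tape_at ?w' [], ?left (counter m ?c))
      (start_conf ps True (Suc j) rs ?w' m)"
    using rewind_start[OF order.refl c, of ?w' m] m by (simp add: tape_at_def[of ?W])
  from reach_trans[OF 1 reach_trans[OF 2 3]] show ?thesis
    by (rule reach_mono) (simp add: length_pass_word[of ps True "Suc j"])
qed

text \<open>The first row suffices to detect the end of a pass: once its exponents are all consumed,
  \<open>Fld\<close> runs over its visited separators up to the semicolon.\<close>

lemma pass_end: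
  assumes "rs = (x, es) # rs'"
  obtains u v where "pass_word ps b (length es) rs = u @ sym_semicolon # v"
    "reach (length (pass_word ps False 0 rs)) (start_conf ps b (length es) rs w m)
      (Fld b, tape_at u (sym_semicolon # v), tape_at w [], counter m 0)"
proof
  let ?p = "fields sym_comma ps" and ?f = "fields (visited b) es"
  let ?v = "concat (map (row_word b (length es)) rs')"
  let ?u = "?p @ [sym_semicolon] @ binary x @ [sym_colon] @ ?f"
  show W: "pass_word ps b (length es) rs = ?u @ sym_semicolon # ?v"
    by (simp add: pass_word_def assms encode_numbers_fields row_word_def)
  have "sym_semicolon \<notin> set ?p"
    using set_fields[of sym_comma ps] by auto
  note 1 = skip_run[OF this, of b "[]" _ "tape_at w []" "counter m 0"]
  have "0 \<notin> set (binary x)" "sym_colon \<notin> set (binary x)"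
    using binary_digits[of x] by auto
  note 2 = row_run[OF this, of b]
  have "reach (length (?u @ [sym_semicolon])) (start_conf ps b (length es) rs w m)
      (Fld b, tape_at ?u (sym_semicolon # ?v), tape_at w [], counter m 0)"
    using reach_trans[OF 1 reach_trans[OF 2 visited_run[of b es]]]
    unfolding start_conf_def W by simp
       (rule reach_mono, auto)
  then show "reach (length (pass_word ps False 0 rs)) (start_conf ps b (length es) rs w m)
      (Fld b, tape_at ?u (sym_semicolon # ?v), tape_at w [], counter m 0)"
    by (rule reach_mono) (simp add: W flip: length_pass_word[of ps b "length es" rs])
qed

lemma restart:
  assumes "rs \<noteq> []" "\<forall>(x, es)\<in>set rs. length es = n"
  shows "reach (2 * length (pass_word ps False 0 rs) + 2) (start_conf ps False n rs w m)
     (start_conf ps True 0 rs w m)"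
proof -
  obtain x es rs' where rs: "rs = (x, es) # rs'"
    using assms(1) by (cases rs) auto
  have n: "length es = n" using assms(2) rs by simp
  obtain u v where W: "pass_word ps False n rs = u @ sym_semicolon # v"
    and 1: "reach (length (pass_word ps False 0 rs)) (start_conf ps False n rs w m)
      (Fld False, tape_at u (sym_semicolon # v), tape_at w [], counter m 0)"
    using pass_end[OF rs, of ps False w m] unfolding n by metis
  \<comment> \<open>\<open>visited False\<close> and \<open>pending True\<close> are the same
    symbol.\<close>
  have "row_word False n r = row_word True 0 r" if "r \<in> set rs" for r
    using assms(2) that by (auto simp: row_word_def)
  then have eq: "pass_word ps False n rs = pass_word ps True 0 rs"
    unfolding pass_word_def by (metis map_cong)
  have 2: "reach 1 (Fld False, tape_at u (sym_semicolon # v), tape_at w [], counter m 0)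
      (Rew True, (word_content (pass_word ps True 0 rs), int (length u) - 1), tape_at w [],
        (fst (counter m 0), snd (counter m 0) - 1))"
    unfolding One_nat_def
    by (rule reach_step) (simp add: reach_refl W tape_at_def[of u] flip: eq,
      simp add: tape_at_def word_content_def)
  have 3: "reach (Suc (length (pass_word ps True 0 rs)))
      (Rew True, (word_content (pass_word ps True 0 rs), int (length u) - 1), tape_at w [],
        (fst (counter m 0), snd (counter m 0) - 1))
      (start_conf ps True 0 rs w (max m 0))"
    by (rule rewind_start) (simp_all add: W flip: eq)
  from reach_trans[OF 1 reach_trans[OF 2 3]] show ?thesis
    by (simp add: length_pass_word[of ps True 0] mult_2)
qed

lemma halt:
  assumes "rs \<noteq> []" "\<forall>(x, es)\<in>set rs. length es = n"
  obtains r t where "reach (length (pass_word ps False 0 rs) + 1) (start_conf ps True n rs w m)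
     (Halt, r, tape_at w [], t)"
proof -
  obtain x es rs' where rs: "rs = (x, es) # rs'"
    using assms(1) by (cases rs) auto
  have n: "length es = n" using assms(2) rs by simp
  obtain u v where 1: "reach (length (pass_word ps False 0 rs)) (start_conf ps True n rs w m)
      (Fld True, tape_at u (sym_semicolon # v), tape_at w [], counter m 0)"
    using pass_end[OF rs, of ps True w m] unfolding n by metis
  have "reach 1 (Fld True, tape_at u (sym_semicolon # v), tape_at w [], counter m 0)
      (Halt, tape_at u (sym_semicolon # v), tape_at w [], counter m 0)"
    unfolding One_nat_def by (rule reach_step) (simp add: reach_refl)
  from that[OF reach_trans[OF 1 this]] show ?thesis .
qed

section \<open>The complete run\<close>

definition max_column_count :: "(nat \<times> nat list) list \<Rightarrow> nat \<Rightarrow> nat" where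
  "max_column_count rs n = Max (insert 0 (column_count rs ` {..<n}))"

definition output_word :: "(nat \<times> nat list) list \<Rightarrow> nat \<Rightarrow> nat \<Rightarrow> nat list" where
  "output_word rs m j =
     concat (map (\<lambda>i. column_word rs i @ [sym_semicolon]) (filter (\<lambda>i. column_count rs i = m) [0..<j]))"

lemma find_max:
  assumes "\<forall>(x, es)\<in>set rs. length es = n" "j \<le> n"
  shows "reach (j * (3 * length (pass_word ps False 0 rs) + 3)) (start_conf ps False 0 rs w 0)
     (start_conf ps False j rs w (max_column_count rs j))"
  using assms(2)
proof (induction j)
  case 0
  \<comment> \<open>Before any scan the maximum is the inserted 0, which matches the empty counter
    tape.\<close>
  show ?case by (simp add: reach_refl max_column_count_def)
next
  case (Suc j)
  have "\<forall>(x, es)\<in>set rs. j < length es" using assms(1) Suc.prems by auto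
  note step = find_max_column[OF this, of ps w "max_column_count rs j"]
  have "max (max_column_count rs j) (column_count rs j) = max_column_count rs (Suc j)"
    by (simp add: max_column_count_def lessThan_Suc insert_commute[of 0] max.commute)
  with reach_trans[OF Suc.IH step] Suc.prems show ?case
    by (simp add: add.commute)
qed

lemma output_word_last: "output_word rs m j = [] \<or> last (output_word rs m j) = sym_semicolon"
  by (induction j) (auto simp: output_word_def)

lemma output_columns:
  assumes "\<forall>(x, es)\<in>set rs. length es = n" "j \<le> n" "\<forall>i<n. column_count rs i \<le> m"
  shows "reach (j * (3 * length (pass_word ps False 0 rs) + 3)) (start_conf ps True 0 rs [] m)
     (start_conf ps True j rs (output_word rs m j) m)"
  using assms(2)
proof (induction j)
  case 0
  show ?case by (simp add: reach_refl output_word_def)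
next
  case (Suc j)
  have "\<forall>(x, es)\<in>set rs. j < length es" using assms(1) Suc.prems by auto
  moreover have "column_count rs j \<le> m" using assms(3) Suc.prems by simp
  ultimately have "reach (3 * length (pass_word ps False 0 rs) + 3)
      (start_conf ps True j rs (output_word rs m j) m)
      (start_conf ps True (Suc j) rs (output_word rs m j @
         (if column_count rs j = m then column_word rs j @ [sym_semicolon] else [])) m)"
    by (rule output_column) (rule output_word_last)
  from reach_trans[OF Suc.IH this] Suc.prems show ?case
    by (simp add: add.commute output_word_def split: if_splits)
qed

text \<open>Each of the two passes makes \<open>n\<close> scans of cost \<open>3 * L + 3\<close>;
  the restart adds \<open>2 * L + 2\<close> and the final detection \<open>L + 1\<close>.\<close>

lemma finder_run:
  fixes ps rs
  assumes "rs \<noteq> []" "\<forall>(x, es)\<in>set rs. length es = n"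
  defines "L \<equiv> length (pass_word ps False 0 rs)"
  obtains r t where "reach (2 * n * (3 * L + 3) + 3 * L + 3) (start_conf ps False 0 rs [] 0)
     (Halt, r, tape_at (output_word rs (max_column_count rs n) n) [], t)"
proof -
  let ?m = "max_column_count rs n"
  obtain r t where 4: "reach (L + 1) (start_conf ps True n rs (output_word rs ?m n) ?m)
     (Halt, r, tape_at (output_word rs ?m n) [], t)"
    using halt[OF assms(1,2)] unfolding L_def by metis
  have "\<forall>i<n. column_count rs i \<le> ?m"
    by (auto simp: max_column_count_def intro!: Max_ge)
  note 3 = output_columns[OF assms(2) order.refl this, of ps, folded L_def]
  note 2 = restart[OF assms(1,2), of ps "[]" ?m, folded L_def]
  note 1 = find_max[OF assms(2) order.refl, of ps "[]", folded L_def]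
  from reach_trans[OF 1 reach_trans[OF 2 reach_trans[OF 3 4]]]
  have "reach (2 * n * (3 * L + 3) + 3 * L + 3) (start_conf ps False 0 rs [] 0)
     (Halt, r, tape_at (output_word rs ?m n) [], t)"
    by (rule reach_mono) (simp add: algebra_simps)
  with that show ?thesis .
qed

lemma tm_init_finder:
  "tm_init finder (pass_word ps False 0 rs) = config_of (start_conf ps False 0 rs [] 0)"
  by (simp add: tm_init_def start_conf_def finder_def tape_at_def counter_def word_content_def
      upt_rec numeral_3_eq_3 fun_eq_iff)

lemma finder_outputs:
  fixes ps rs
  assumes "rs \<noteq> []" "\<forall>(x, es)\<in>set rs. length es = n"
  defines "L \<equiv> length (pass_word ps False 0 rs)"
  shows "tm_outputs_within finder (pass_word ps False 0 rs) (2 * n * (3 * L + 3) + 3 * L + 3)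
     (output_word rs (max_column_count rs n) n)"
proof -
  let ?v = "output_word rs (max_column_count rs n) n"
  obtain r t k where "k \<le> 2 * n * (3 * L + 3) + 3 * L + 3"
    "(step ^^ k) (start_conf ps False 0 rs [] 0) = (Halt, r, tape_at ?v [], t)"
    using finder_run[OF assms(1,2), of ps, folded L_def] unfolding reach_def by metis
  then show ?thesis
    unfolding tm_outputs_within_def tm_init_finder funpow_tm_step_finder
    by (intro exI[of _ k]) (simp add: finder_def tape_at_def)
qed

section \<open>Correctness of the machine\<close>

definition support :: "nat list \<Rightarrow> nat list list \<Rightarrow> nat \<Rightarrow> nat set" where
  "support a E j = {i. i < length a \<and> E ! i ! j \<noteq> 0}"

lemma finite_support [simp]: "finite (support a E j)"
  by (simp add: support_def)

lemma column_count_zip: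
  assumes "length E = length a"
  shows "column_count (zip a E) j = card (support a E j)"
  using assms
  by (auto simp: column_count_def length_filter_conv_card support_def intro!: arg_cong[of _ _ card])

lemma column_word_zip:
  assumes "length E = length a"
  shows "column_word (zip a E) j =
     map (\<lambda>i. if i \<in> support a E j then sym_one else sym_zero) [0..<length a]"
  using assms by (auto simp: column_word_def bit_symbol_def support_def intro!: nth_equalityI)

lemma output_word_zip:
  assumes "length E = length a"
  shows "output_word (zip a E) m n =
     encode_sublists (length a) (map (support a E) (filter (\<lambda>j. card (support a E j) = m) [0..<n]))"
  by (simp add: output_word_def encode_sublists_def column_count_zip[OF assms]
      column_word_zip[OF assms] o_def)

lemma encode_instance_pass_word: "encode_instance a ps E = pass_word ps False 0 (zip a E)"
  by (auto simp: encode_instance_def pass_word_def row_word_def encode_numbers_fields pending_def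
      intro!: arg_cong[of _ _ concat])

section \<open>Common prime factors and largest sublists\<close>

lemma prime_dvd_nth_iff:
  assumes "prime_factorizations a ps E" "i < length a" "prime p"
  shows "p dvd a ! i \<longleftrightarrow> (\<exists>j<length ps. p = ps ! j \<and> E ! i ! j \<noteq> 0)"
proof -
  have ps: "prime (ps ! j)" if "j < length ps" for j
    using assms(1) that by (auto simp: prime_factorizations_def)
  have "a ! i = (\<Prod>j<length ps. ps ! j ^ (E ! i ! j))"
    using assms(1,2) by (simp add: prime_factorizations_def)
  then have "p dvd a ! i \<longleftrightarrow> (\<exists>j<length ps. p dvd ps ! j ^ (E ! i ! j))"
    using assms(3) by (simp add: prime_dvd_prod_iff Bex_def)
  also have "\<dots> \<longleftrightarrow> (\<exists>j<length ps. p = ps ! j \<and> E ! i ! j \<noteq> 0)"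
  proof (intro ex_cong1 conj_cong refl)
    fix j assume "j < length ps"
    note pr = ps[OF this] assms(3)
    show "p dvd ps ! j ^ (E ! i ! j) \<longleftrightarrow> p = ps ! j \<and> E ! i ! j \<noteq> 0"
      using pr by (cases "E ! i ! j = 0") (auto simp: prime_dvd_power_iff primes_dvd_imp_eq)
  qed
  finally show ?thesis .
qed

lemma noncoprime_sublist_iff:
  assumes "prime_factorizations a ps E"
  shows "noncoprime_sublist a I \<longleftrightarrow> I \<noteq> {} \<and> (\<exists>j<length ps. I \<subseteq> support a E j)"
proof
  assume I: "noncoprime_sublist a I"
  then obtain p where p: "prime p" "p dvd sublist_gcd a I"
    using prime_factor_nat by (auto simp: noncoprime_sublist_def)
  have dvd: "p dvd a ! i" if "i \<in> I" for i
    using p(2) Gcd_dvd that unfolding sublist_gcd_def by (meson dvd_trans imageI)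
  have bound: "i < length a" if "i \<in> I" for i
    using I that by (auto simp: noncoprime_sublist_def)
  obtain i0 where i0: "i0 \<in> I" using I by (auto simp: noncoprime_sublist_def)
  then obtain j where j: "j < length ps" "p = ps ! j"
    using prime_dvd_nth_iff[OF assms bound p(1)] dvd by blast
  have "i \<in> support a E j" if i: "i \<in> I" for i
  proof -
    obtain k where "k < length ps" "p = ps ! k" "E ! i ! k \<noteq> 0"
      using prime_dvd_nth_iff[OF assms bound[OF i] p(1)] dvd[OF i] by blast
    \<comment> \<open>Distinctness of the primes makes the index found at \<open>i0\<close> serve
      for every other position.\<close>
    moreover have "distinct ps" using assms by (simp add: prime_factorizations_def)
    ultimately show ?thesis
      using j bound[OF i] by (auto simp: support_def nth_eq_iff_index_eq)
  qed
  then show "I \<noteq> {} \<and> (\<exists>j<length ps. I \<subseteq> support a E j)"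
    using i0 j(1) by blast
next
  assume "I \<noteq> {} \<and> (\<exists>j<length ps. I \<subseteq> support a E j)"
  then obtain j where I: "I \<noteq> {}" and j: "j < length ps" "I \<subseteq> support a E j" by blast
  have p: "prime (ps ! j)" using assms j(1) by (auto simp: prime_factorizations_def)
  have "ps ! j dvd a ! i" if "i \<in> I" for i
    using prime_dvd_nth_iff[OF assms _ p, of i] that j by (auto simp: support_def)
  then have "ps ! j dvd sublist_gcd a I"
    by (auto simp: sublist_gcd_def intro!: Gcd_greatest)
  then have "sublist_gcd a I \<noteq> 1"
    using p by (auto dest: not_prime_unit)
  with I j(2) show "noncoprime_sublist a I"
    by (auto simp: noncoprime_sublist_def support_def)
qed

lemma largest_sublists_eq:
  assumes "instance_ok a ps E"
  defines "n \<equiv> length ps"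
  defines "m \<equiv> max_column_count (zip a E) n"
  shows "largest_sublists a = support a E ` {j. j < n \<and> card (support a E j) = m}"
proof -
  have pf: "prime_factorizations a ps E" and len: "length E = length a"
    using assms(1) by (auto simp: instance_ok_def prime_factorizations_def)
  note nc = noncoprime_sublist_iff[OF pf, folded n_def]
  let ?S = "support a E"
  have m: "m = Max (insert 0 ((\<lambda>j. card (?S j)) ` {..<n}))"
    by (simp add: m_def max_column_count_def column_count_zip[OF len])
  have le: "card (?S j) \<le> m" if "j < n" for j
    using that unfolding m by (intro Max_ge) auto
  have le': "card I \<le> m" if I: "noncoprime_sublist a I" for I
  proof -
    obtain j where "j < n" "I \<subseteq> ?S j" using I unfolding nc by blast
    with le[of j] card_mono[of "?S j" I] show ?thesis by simp
  qed
  \<comment> \<open>Positivity shows that \<open>m\<close> is attained by a column and not just by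
    the inserted 0, and that supports of size \<open>m\<close> are nonempty.\<close>
  have pos: "m > 0"
  proof -
    obtain I where I: "noncoprime_sublist a I"
      using assms(1) by (auto simp: instance_ok_def)
    then have "finite I" "I \<noteq> {}" by (auto simp: noncoprime_sublist_def finite_subset)
    then have "card I > 0" by (simp add: card_gt_0_iff)
    with le'[OF I] show ?thesis by simp
  qed
  have "m \<in> insert 0 ((\<lambda>j. card (?S j)) ` {..<n})"
    unfolding m by (rule Max_in) auto
  with pos obtain j0 where j0: "j0 < n" "card (?S j0) = m" by auto
  have ncS: "noncoprime_sublist a (?S j)" if "j < n" "card (?S j) = m" for j
  proof -
    have "?S j \<noteq> {}" using that(2) pos by force
    with that(1) show ?thesis unfolding nc by blast
  qed
  show ?thesis
  proof (intro equalityI subsetI)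
    fix I assume "I \<in> largest_sublists a"
    then have I: "noncoprime_sublist a I" and "m \<le> card I"
      using ncS[OF j0] j0(2) by (auto simp: largest_sublists_def is_arg_max_linorder)
    then obtain j where j: "j < n" "I \<subseteq> ?S j" unfolding nc by blast
    \<comment> \<open>The chain \<open>card I \<le> card (?S j) \<le> m \<le> card I\<close>
      collapses to equalities, so \<open>I\<close> is the whole support.\<close>
    then have "card I \<le> card (?S j)" by (simp add: card_mono)
    with \<open>m \<le> card I\<close> le[OF j(1)] have "card I = card (?S j)" "card (?S j) = m" by auto
    with j show "I \<in> ?S ` {j. j < n \<and> card (?S j) = m}"
      using card_subset_eq[of "?S j" I] by auto
  next
    fix I assume "I \<in> ?S ` {j. j < n \<and> card (?S j) = m}"
    then show "I \<in> largest_sublists a"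
      using ncS le' by (auto simp: largest_sublists_def is_arg_max_linorder)
  qed
qed

lemma length_le_input_size: "length ps \<le> input_size a ps E"
proof -
  have "length ps \<le> length (fields sym_comma ps)"
    by (induction ps) auto
  then show ?thesis
    by (simp add: input_size_def encode_instance_def encode_numbers_fields)
qed

lemma card_largest_sublists_le:
  assumes "instance_ok a ps E"
  shows "card (largest_sublists a) \<le> input_size a ps E"
proof -
  have "card (largest_sublists a) \<le> card {j. j < length ps \<and> card (support a E j) =
      max_column_count (zip a E) (length ps)}"
    unfolding largest_sublists_eq[OF assms] by (rule card_image_le) simp
  also have "\<dots> \<le> card {..<length ps}"
    by (rule card_mono) auto
  finally show ?thesis
    using length_le_input_size[of ps a E] by simp
qed

lemma tm_outputs_within_mono:
  "tm_outputs_within M w t v \<Longrightarrow> t \<le> t' \<Longrightarrow> tm_outputs_within M w t' v"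
  unfolding tm_outputs_within_def by (meson le_trans)

lemma finder_correct: "finds_largest_sublists_in_polynomial_time finder"
  unfolding finds_largest_sublists_in_polynomial_time_def
\<comment> \<open>Since the number \<open>n\<close> of primes is at most the input size
  \<open>L\<close>, the time is at most \<open>2 * L * (3 * L + 3) + 3 * L + 3\<close>, which is
  this polynomial at \<open>L\<close>.\<close>
proof (intro conjI exI[of _ "[:3, 9, 6:]"] allI impI turing_machine_ok_finder)
  show "2 \<le> tapes finder" "sym_semicolon < symbols finder"
    by (simp_all add: finder_def)
next
  fix a ps E assume ok: "instance_ok a ps E"
  let ?rs = "zip a E" and ?n = "length ps"
  let ?m = "max_column_count ?rs ?n" and ?L = "input_size a ps E"
  let ?Is = "map (support a E) (filter (\<lambda>j. card (support a E j) = ?m) [0..<?n])"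
  have len: "length E = length a" and es: "\<forall>es\<in>set E. length es = ?n"
    using ok by (auto simp: instance_ok_def prime_factorizations_def)
  have "a \<noteq> []"
    using ok by (auto simp: instance_ok_def noncoprime_sublist_def)
  then have ne: "?rs \<noteq> []" using len by (cases E) (auto simp: zip_eq_Nil_iff)
  have "\<forall>(x, es)\<in>set ?rs. length es = ?n"
    using es by (auto dest: set_zip_rightD)
  from finder_outputs[OF ne this, of ps]
  have out: "tm_outputs_within finder (encode_instance a ps E) (2 * ?n * (3 * ?L + 3) + 3 * ?L + 3)
      (encode_sublists (length a) ?Is)"
    by (simp only: encode_instance_pass_word output_word_zip[OF len] input_size_def)
  have "?n * (3 * ?L + 3) \<le> ?L * (3 * ?L + 3)"
    using length_le_input_size[of ps a E] by (rule mult_right_mono) simp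
  then have "2 * ?n * (3 * ?L + 3) + 3 * ?L + 3 \<le> poly [:3, 9, 6:] ?L"
    by (simp add: algebra_simps)
  with out have out': "tm_outputs_within finder (encode_instance a ps E) (poly [:3, 9, 6:] ?L)
      (encode_sublists (length a) ?Is)"
    by (rule tm_outputs_within_mono)
  have "set ?Is = largest_sublists a"
    by (auto simp: largest_sublists_eq[OF ok])
  with out' show "\<exists>Is. set Is = largest_sublists a \<and>
      tm_outputs_within finder (encode_instance a ps E) (poly [:3, 9, 6:] ?L)
        (encode_sublists (length a) Is)"
    by blast
qed

section \<open>The fan and its Moebius function\<close>

text \<open>By Bezout, a common root of unity for \<open>g\<close> and \<open>f\<close> is one for
  their gcd. So inclusion puts the \<open>g\<close> elements of one group into a group of
  \<open>gcd g f\<close> elements, which forces \<open>gcd g f = g\<close>.\<close>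

lemma roots_group_subset_iff:
  assumes "f > 0" "g > 0"
  shows "roots_group g \<subseteq> roots_group f \<longleftrightarrow> g dvd f"
proof
  assume sub: "roots_group g \<subseteq> roots_group f"
  obtain x y where bezout: "g * x = f * y + gcd g f"
    using bezout_nat[of g f] assms by auto
  have "roots_group g \<subseteq> roots_group (gcd g f)"
  proof
    fix z assume z: "z \<in> roots_group g"
    then have "z ^ g = 1" "z ^ f = 1" using sub by (auto simp: roots_group_def)
    then have "z ^ gcd g f = z ^ (f * y + gcd g f)"
      by (simp add: power_add power_mult)
    also have "\<dots> = 1"
      using \<open>z ^ g = 1\<close> by (simp add: power_mult flip: bezout)
    finally show "z \<in> roots_group (gcd g f)" by (simp add: roots_group_def)
  qed
  moreover have "gcd g f > 0" using assms by simp
  moreover from this have "finite (roots_group (gcd g f))"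
    unfolding roots_group_def by (intro finite_roots_unity) linarith
  ultimately have "g \<le> gcd g f"
    using card_mono[of "roots_group (gcd g f)" "roots_group g"] assms
    by (simp add: roots_group_def card_roots_unity_eq)
  then have "gcd g f = g"
    using assms by (simp add: dvd_imp_le le_antisym)
  then show "g dvd f" by (metis gcd_dvd2)
next
  assume "g dvd f"
  then show "roots_group g \<subseteq> roots_group f"
    by (auto simp: roots_group_def power_mult elim!: dvdE)
qed

lemma roots_group_eq_iff:
  assumes "f > 0" "g > 0"
  shows "roots_group f = roots_group g \<longleftrightarrow> f = g"
  using roots_group_subset_iff[OF assms] roots_group_subset_iff[OF assms(2,1)]
  by (auto intro: dvd_antisym)

section \<open>The Moebius function of a fan\<close>

lemma partial_order_P_tilde: "partial_order_on (P_tilde d a) (P_tilde_order d a)"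
  by (auto simp: partial_order_on_def preorder_on_def P_tilde_order_def refl_on_def
      intro!: transI antisymI)

lemma partial_order_P_hat: "partial_order_on (P_hat d a) (P_hat_order d a)"
  by (auto simp: partial_order_on_def preorder_on_def P_hat_def P_hat_order_def P_tilde_order_def
      refl_on_def intro!: transI antisymI)

lemma finite_gcds_gt: "finite (gcds_gt d a)"
proof -
  have "gcds_gt d a \<subseteq> sublist_gcd a ` Pow {..<length a}"
    by (auto simp: gcds_gt_def)
  then show ?thesis by (rule finite_subset) simp
qed

lemma finite_P_hat: "finite (P_hat d a)"
  by (simp add: P_hat_def P_tilde_def finite_gcds_gt)

text \<open>Everything lies above \<open>None\<close>, so the incomparable case of the recursion
  never arises.\<close>

lemma moebius_P_hat:
  assumes "y \<in> P_hat d a"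
  shows "poset_moebius (P_hat d a) (P_hat_order d a) None y =
     (if y = None then 1
      else - (\<Sum>z\<in>{z \<in> P_hat d a. (z, y) \<in> P_hat_order d a \<and> z \<noteq> y}.
             poset_moebius (P_hat d a) (P_hat_order d a) None z))"
proof -
  have "(None, z) \<in> P_hat_order d a \<longleftrightarrow> z \<in> P_hat d a" for z
    by (auto simp: P_hat_order_def)
  moreover have "None \<in> P_hat d a" by (simp add: P_hat_def)
  ultimately show ?thesis
    using assms finite_P_hat partial_order_P_hat
    by (subst poset_moebius.simps) (auto intro!: sum.cong)
qed

lemma moebius_None: "poset_moebius (P_hat d a) (P_hat_order d a) None None = 1"
  by (subst moebius_P_hat) (simp_all add: P_hat_def)

text \<open>Strictly below an element other than the top there is only \<open>None\<close>, of value
  1, which gives -1. Below the top there are \<open>None\<close> and all the other elements, and the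
  value is minus the sum of theirs.\<close>

lemma fan_moebius:
  assumes fan: "fan (P_tilde d a) (P_tilde_order d a) T" and X: "X \<in> P_tilde d a"
  shows "poset_moebius (P_hat d a) (P_hat_order d a) None (Some X) =
     (if X = T then int (card (P_tilde d a)) - 2 else -1)"
proof -
  let ?mu = "poset_moebius (P_hat d a) (P_hat_order d a) None"
  have top: "(Y, T) \<in> P_tilde_order d a" if "Y \<in> P_tilde d a" for Y
    using fan that by (auto simp: fan_def)
  have T: "T \<in> P_tilde d a" using fan by (simp add: fan_def)
  have other: "?mu (Some Y) = -1" if Y: "Y \<in> P_tilde d a" "Y \<noteq> T" for Y
  proof -
    \<comment> \<open>By antisymmetry the top is not below \<open>Y\<close>, which leaves
      \<open>None\<close> as the only smaller element.\<close>
    have "(T, Y) \<notin> P_tilde_order d a"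
      using partial_order_onD(3)[OF partial_order_P_tilde] top[OF Y(1)] Y(2) by (auto dest: antisymD)
    then have "{z \<in> P_hat d a. (z, Some Y) \<in> P_hat_order d a \<and> z \<noteq> Some Y} = {None}"
      using fan Y by (auto simp: P_hat_def P_hat_order_def fan_def)
    then show ?thesis
      using Y by (subst moebius_P_hat) (simp_all add: moebius_None, simp add: P_hat_def)
  qed
  show ?thesis
  proof (cases "X = T")
    case True
    have fin: "finite (P_tilde d a)" by (simp add: P_tilde_def finite_gcds_gt)
    have set: "{z \<in> P_hat d a. (z, Some T) \<in> P_hat_order d a \<and> z \<noteq> Some T} =
        insert None (Some ` (P_tilde d a - {T}))"
      using top T by (auto simp: P_hat_def P_hat_order_def)
    have "?mu (Some T) = - (?mu None + (\<Sum>Y\<in>P_tilde d a - {T}. ?mu (Some Y)))"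
      using T fin
      by (subst moebius_P_hat) (simp_all add: set sum.reindex, simp add: P_hat_def)
    also have "(\<Sum>Y\<in>P_tilde d a - {T}. ?mu (Some Y)) = (\<Sum>Y\<in>P_tilde d a - {T}. -1)"
      by (rule sum.cong) (auto simp: other)
    also have "\<dots> = 1 - int (card (P_tilde d a))"
      using T fin card_gt_0_iff[of "P_tilde d a"] by (auto simp: card_Diff_singleton of_nat_diff)
    finally show ?thesis using True by (simp add: moebius_None)
  qed (use other X in simp)
qed

lemma fan_structure:
  assumes ok: "instance_ok a ps E" and l: "l = int (largest_size a)"
  defines "\<G> \<equiv> gcds_gt (l - 1) a"
  shows "1 \<in> \<G>" and "\<forall>f\<in>\<G>. f > 0"
    and "\<forall>f\<in>\<G> - {1}. \<forall>g\<in>\<G> - {1}. f dvd g \<longrightarrow> f = g"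
proof -
  let ?C = "{I. noncoprime_sublist a I}"
  have "?C \<subseteq> Pow {..<length a}" by (auto simp: noncoprime_sublist_def)
  then have fin: "finite ?C" by (rule finite_subset) simp
  have max: "card I \<le> largest_size a" if "noncoprime_sublist a I" for I
    unfolding largest_size_def using that fin by (intro Max_ge) auto
  have "largest_size a \<in> card ` ?C"
    unfolding largest_size_def using ok fin by (intro Max_in) (auto simp: instance_ok_def)
  then obtain I0 where I0: "noncoprime_sublist a I0" "card I0 = largest_size a" by auto
  then have I0': "I0 \<subseteq> {..<length a}" "I0 \<noteq> {}" by (auto simp: noncoprime_sublist_def)
  then have "card I0 > 0" by (meson card_gt_0_iff finite_lessThan finite_subset)
  \<comment> \<open>Hence \<open>l - 1 \<ge> 0\<close>, so the empty sublist with its gcd 0 does not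
    contribute to the gcds.\<close>
  then have size: "largest_size a \<ge> 1" using I0(2) by simp
  \<comment> \<open>The whole list is long enough to contribute, and its gcd is 1.\<close>
  have "card I0 \<le> length a" using card_mono[OF _ I0'(1)] by simp
  moreover have "(\<lambda>i. a ! i) ` {..<length a} = set a" by (auto simp: in_set_conv_nth)
  then have "sublist_gcd a {..<length a} = 1"
    using ok by (simp add: sublist_gcd_def instance_ok_def)
  ultimately show "1 \<in> \<G>"
    unfolding \<G>_def gcds_gt_def l using I0(2) by (intro CollectI exI[of _ "{..<length a}"]) auto
  \<comment> \<open>Sublists longer than the largest size are coprime, so a gcd other than 1 pins
    the size down exactly.\<close>
  have mem: "f > 0 \<and> (f \<noteq> 1 \<longrightarrow> noncoprime_sublist a I \<and> card I = largest_size a)"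
    if f: "f = sublist_gcd a I" and I: "I \<subseteq> {..<length a}" "int (card I) > l - 1" for f I
  proof -
    have "card I \<ge> largest_size a" using I l by linarith
    then obtain i where i: "i \<in> I" using size by fastforce
    then have "a ! i > 0" using ok I by (auto simp: instance_ok_def)
    moreover have "f dvd a ! i" using i by (auto simp: f sublist_gcd_def intro!: Gcd_dvd)
    ultimately have "f > 0" by (auto intro: Nat.gr0I)
    moreover have "noncoprime_sublist a I" if "f \<noteq> 1"
      using that f i I by (auto simp: noncoprime_sublist_def)
    ultimately show ?thesis using max \<open>card I \<ge> largest_size a\<close> by (auto intro: le_antisym)
  qed
  then show "\<forall>f\<in>\<G>. f > 0" by (auto simp: \<G>_def gcds_gt_def)
  show "\<forall>f\<in>\<G> - {1}. \<forall>g\<in>\<G> - {1}. f dvd g \<longrightarrow> f = g"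
  proof (intro ballI impI)
    fix f g assume fg: "f \<in> \<G> - {1}" "g \<in> \<G> - {1}" "f dvd g"
    obtain I where I: "f = sublist_gcd a I" "noncoprime_sublist a I" "card I = largest_size a"
      using fg(1) mem by (auto simp: \<G>_def gcds_gt_def)
    obtain J where J: "g = sublist_gcd a J" "noncoprime_sublist a J" "card J = largest_size a"
      using fg(2) mem by (auto simp: \<G>_def gcds_gt_def)
    have "f dvd a ! i" if "i \<in> I" for i
      using that by (auto simp: I(1) sublist_gcd_def intro!: Gcd_dvd)
    moreover have "f dvd a ! i" if "i \<in> J" for i
      using that dvd_trans[OF fg(3)] by (auto simp: J(1) sublist_gcd_def intro!: Gcd_dvd)
    ultimately have "f dvd sublist_gcd a (I \<union> J)"
      by (auto simp: sublist_gcd_def[of a "I \<union> J"] intro!: Gcd_greatest)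
    then have "noncoprime_sublist a (I \<union> J)"
      using I(2) J(2) fg(1) by (auto simp: noncoprime_sublist_def)
    then have "card (I \<union> J) \<le> largest_size a" "finite (I \<union> J)"
      using max by (auto simp: noncoprime_sublist_def finite_subset)
    then have "I = I \<union> J" "J = I \<union> J"
      by (metis I(3) card_seteq Un_upper1, metis J(3) card_seteq Un_upper2)
    then show "f = g" using I(1) J(1) by auto
  qed
qed

lemma fan_and_moebius:
  assumes ok: "instance_ok a ps E" and l: "l = int (largest_size a)"
  shows "(\<exists>F. finite F \<and> 1 \<notin> F \<and> gcds_gt (l - 1) a = insert 1 F \<and>
          fan (P_tilde (l - 1) a) (P_tilde_order (l - 1) a) (roots_group 1) \<and>
          (\<forall>f\<in>F. \<forall>g\<in>F. f \<noteq> g \<longrightarrow>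
             (roots_group f, roots_group g) \<notin> P_tilde_order (l - 1) a \<and> \<not> f dvd g)) \<and>
       (\<forall>f\<in>gcds_gt (l - 1) a. f \<noteq> 1 \<longrightarrow> mu (l - 1) a f = 1) \<and>
       mu (l - 1) a 1 = 1 - (int (card (gcds_gt (l - 1) a)) - 1)"
proof -
  let ?G = "gcds_gt (l - 1) a" and ?P = "P_tilde (l - 1) a" and ?r = "P_tilde_order (l - 1) a"
  note str = fan_structure[OF ok l]
  have pos: "f > 0" if "f \<in> ?G" for f using str(2) that by blast
  have antichain: "\<not> g dvd f" if "f \<in> ?G" "g \<in> ?G" "f \<noteq> g" "f \<noteq> 1" "g \<noteq> 1" for f g
    using str(3) that by (metis DiffI singletonD)
  have order: "(roots_group f, roots_group g) \<in> ?r \<longleftrightarrow> g dvd f" if "f \<in> ?G" "g \<in> ?G" for f g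
    using that pos by (auto simp: P_tilde_order_def P_tilde_def roots_group_subset_iff)
  have eq: "roots_group f = roots_group g \<longleftrightarrow> f = g" if "f \<in> ?G" "g \<in> ?G" for f g
    using that pos by (simp add: roots_group_eq_iff)
  have fan: "fan ?P ?r (roots_group 1)"
    unfolding fan_def
  proof (intro conjI partial_order_P_tilde)
    show "roots_group 1 \<in> ?P" using str(1) by (simp add: P_tilde_def)
    show "\<forall>X\<in>?P. (X, roots_group 1) \<in> ?r"
      using order str(1) by (auto simp: P_tilde_def)
    show "\<forall>X\<in>?P - {roots_group 1}. \<forall>Y\<in>?P - {roots_group 1}. X \<noteq> Y \<longrightarrow> (X, Y) \<notin> ?r"
      using order antichain by (auto simp: P_tilde_def)
  qed
  \<comment> \<open>Distinct gcds give distinct groups, so the poset may be counted by its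
    gcds.\<close>
  have "inj_on roots_group ?G" using eq by (auto intro: inj_onI)
  then have card: "card ?P = card ?G" by (simp add: P_tilde_def card_image)
  \<comment> \<open>\<open>mu\<close> negates the Moebius value of the poset, turning
    \<open>card ?P - 2\<close> and -1 into these values.\<close>
  have mu: "mu (l - 1) a f = (if f = 1 then 2 - int (card ?G) else 1)" if "f \<in> ?G" for f
    using fan_moebius[OF fan, of "roots_group f"] that eq[OF that str(1)]
    by (simp add: mu_def P_tilde_def[of "l - 1" a] flip: card)
  show ?thesis
  proof (intro conjI exI[of _ "?G - {1}"] fan)
    show "\<forall>f\<in>?G - {1}. \<forall>g\<in>?G - {1}. f \<noteq> g \<longrightarrow>
        (roots_group f, roots_group g) \<notin> ?r \<and> \<not> f dvd g"
      using order antichain by auto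
  qed (use str(1) mu finite_gcds_gt in auto)
qed

theorem theorem4p1:
  shows "(\<exists>M. finds_largest_sublists_in_polynomial_time M) \<and>
    (\<exists>q :: nat poly. \<forall>a ps E. instance_ok a ps E \<longrightarrow>
       card (largest_sublists a) \<le> poly q (input_size a ps E)) \<and>
    (\<forall>a ps E l. instance_ok a ps E \<and> l = int (largest_size a) \<longrightarrow>
       (\<exists>F. finite F \<and> 1 \<notin> F \<and> gcds_gt (l - 1) a = insert 1 F \<and>
          fan (P_tilde (l - 1) a) (P_tilde_order (l - 1) a) (roots_group 1) \<and>
          (\<forall>f\<in>F. \<forall>g\<in>F. f \<noteq> g \<longrightarrow>
             (roots_group f, roots_group g) \<notin> P_tilde_order (l - 1) a \<and> \<not> f dvd g)) \<and>
       (\<forall>f\<in>gcds_gt (l - 1) a. f \<noteq> 1 \<longrightarrow> mu (l - 1) a f = 1) \<and>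
       mu (l - 1) a 1 = 1 - (int (card (gcds_gt (l - 1) a)) - 1))"
proof (intro conjI allI impI; (elim conjE)?)
  show "\<exists>M. finds_largest_sublists_in_polynomial_time M"
    using finder_correct by blast
  show "\<exists>q :: nat poly. \<forall>a ps E. instance_ok a ps E \<longrightarrow>
      card (largest_sublists a) \<le> poly q (input_size a ps E)"
    \<comment> \<open>The identity polynomial: the number of sublists is bounded by the input size
      itself.\<close>
    using card_largest_sublists_le by (intro exI[of _ "[:0, 1:]"]) auto
qed (use fan_and_moebius in blast)+

end
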